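(* Every avoidable hybrid formula is avoided by $b_4$.
   Context: A formula is a finite set of non-empty words over variables (fragments), written separated by dots. An occurrence of a formula $f$ in a word $w$ is a non-erasing morphism $h$ from variables to non-empty words such that $h(\phi)$ is a factor of $w$ for every fragment $\phi$; $w$ avoids $f$ if it has no occurrence; $f$ is avoidable if some infinite word over a finite alphabet avoids it. A formula is hybrid if each of its fragments either has length $2$ or has the form $XYX$ with $X,Y$ variables (possibly equal). $b_4$ is the fixed point starting with $0$ of the morphism $0\mapsto 01,\ 1\mapsto 03,\ 2\mapsto 21,\ 3\mapsto 23$. *)

theory Defs
  imports "HOL-Library.Omega_Words_Fun"
begin

text \<open>
  Finite words are lists and infinite words are functions on the naturals
  (\<^typ>\<open>'a word\<close>). A morphism is given by the images of the letters.
\<close>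

definition morph :: "('v \<Rightarrow> 'a list) \<Rightarrow> 'v list \<Rightarrow> 'a list" where
  "morph h u = concat (map h u)"

definition non_erasing :: "('v \<Rightarrow> 'a list) \<Rightarrow> bool" where
  "non_erasing h \<longleftrightarrow> (\<forall>x. h x \<noteq> [])"

definition factor :: "'a list \<Rightarrow> 'a word \<Rightarrow> bool" where
  "factor u w \<longleftrightarrow> (\<exists>i j. u = w [i \<rightarrow> j])"

definition formula :: "'v list set \<Rightarrow> bool" where
  "formula f \<longleftrightarrow> finite f \<and> [] \<notin> f"

definition occurrence :: "('v \<Rightarrow> 'a list) \<Rightarrow> 'v list set \<Rightarrow> 'a word \<Rightarrow> bool" where
  "occurrence h f w \<longleftrightarrow> non_erasing h \<and> (\<forall>\<phi>\<in>f. factor (morph h \<phi>) w)"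

definition avoids :: "'a word \<Rightarrow> 'v list set \<Rightarrow> bool" where
  "avoids w f \<longleftrightarrow> \<not> (\<exists>h. occurrence h f w)"

text \<open>Every finite alphabet can be renamed to a finite set of naturals.\<close>

definition avoidable :: "'v list set \<Rightarrow> bool" where
  "avoidable f \<longleftrightarrow> (\<exists>w :: nat word. finite (range w) \<and> avoids w f)"

definition hybrid :: "'v list set \<Rightarrow> bool" where
  "hybrid f \<longleftrightarrow> formula f \<and> (\<forall>\<phi>\<in>f. length \<phi> = 2 \<or> (\<exists>X Y. \<phi> = [X, Y, X]))"

text \<open>
  For a non-erasing morphism \<open>h\<close>, the image of the infinite word \<open>w\<close> is the unique
  infinite word having the images of all finite prefixes of \<open>w\<close> as prefixes.
\<close>

definition fixed_point :: "('a \<Rightarrow> 'a list) \<Rightarrow> 'a word \<Rightarrow> bool" where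
  "fixed_point h w \<longleftrightarrow> (\<forall>n. \<exists>k. morph h (prefix n w) = prefix k w)"

datatype letter = L0 | L1 | L2 | L3

fun b4_morphism :: "letter \<Rightarrow> letter list" where
  "b4_morphism L0 = [L0, L1]"
| "b4_morphism L1 = [L0, L3]"
| "b4_morphism L2 = [L2, L1]"
| "b4_morphism L3 = [L2, L3]"

definition b4 :: "letter word" where
  "b4 = (THE w. w 0 = L0 \<and> fixed_point b4_morphism w)"

lemma length_b4_morphism: "length (b4_morphism x) = 2"
  by (cases x) auto

lemma length_morph_b4_morphism: "length (morph b4_morphism u) = 2 * length u"
  by (induction u) (auto simp: morph_def length_b4_morphism)

lemma b4_morphism_eq: "b4_morphism x = [b4_morphism x ! 0, b4_morphism x ! 1]"
  by (cases x) auto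

lemma fixed_point_b4_iff:
  "fixed_point b4_morphism w \<longleftrightarrow>
    (\<forall>n. w (2 * n) = b4_morphism (w n) ! 0 \<and> w (2 * n + 1) = b4_morphism (w n) ! 1)"
  (is "?L \<longleftrightarrow> ?R")
proof
  assume L: ?L
  have eq: "morph b4_morphism (prefix n w) = prefix (2 * n) w" for n
  proof -
    obtain k where k: "morph b4_morphism (prefix n w) = prefix k w"
      using L by (auto simp: fixed_point_def)
    from arg_cong[OF this, of length] have "k = 2 * n"
      by (simp add: length_morph_b4_morphism)
    with k show ?thesis by simp
  qed
  show ?R
  proof
    fix n
    have "prefix (2 * n) w @ b4_morphism (w n) = morph b4_morphism (prefix (Suc n) w)"
      using eq[of n] by (simp add: morph_def subsequence_def)
    also have "\<dots> = prefix (2 * n) w @ [w (2 * n), w (2 * n + 1)]"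
      using eq[of "Suc n"] by (simp add: subsequence_def)
    finally show "w (2 * n) = b4_morphism (w n) ! 0 \<and> w (2 * n + 1) = b4_morphism (w n) ! 1"
      by simp
  qed
next
  assume R: ?R
  have "morph b4_morphism (prefix n w) = prefix (2 * n) w" for n
  proof (induction n)
    case 0
    show ?case by (simp add: morph_def subsequence_def)
  next
    case (Suc n)
    have "b4_morphism (w n) = [w (2 * n), w (2 * n + 1)]"
      using R b4_morphism_eq[of "w n"] by metis
    with Suc show ?case by (simp add: morph_def subsequence_def)
  qed
  then show ?L by (auto simp: fixed_point_def)
qed

fun b4_rec :: "nat \<Rightarrow> letter" where
  "b4_rec n = (if n = 0 then L0 else b4_morphism (b4_rec (n div 2)) ! (n mod 2))"

declare b4_rec.simps [simp del]

lemma b4_unique_fixed_point: "\<exists>!w. w 0 = L0 \<and> fixed_point b4_morphism w"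
proof (rule ex1I[of _ b4_rec])
  have "b4_rec (2 * n) = b4_morphism (b4_rec n) ! 0" for n
    by (cases "n = 0") (simp_all add: b4_rec.simps[of "2 * n"] b4_rec.simps[of 0])
  moreover have "b4_rec (2 * n + 1) = b4_morphism (b4_rec n) ! 1" for n
    by (simp add: b4_rec.simps[of "Suc (2 * n)"])
  ultimately show "b4_rec 0 = L0 \<and> fixed_point b4_morphism b4_rec"
    by (simp add: fixed_point_b4_iff b4_rec.simps[of 0])
next
  fix w assume w: "w 0 = L0 \<and> fixed_point b4_morphism w"
  have "w n = b4_rec n" for n
  proof (induction n rule: less_induct)
    case (less n)
    show ?case
    proof (cases "n = 0")
      case True
      then show ?thesis using w by (simp add: b4_rec.simps[of 0])
    next
      case False
      have "w n = b4_morphism (w (n div 2)) ! (n mod 2)"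
      proof (cases "even n")
        case True
        then obtain k where "n = 2 * k" by blast
        with w show ?thesis by (simp add: fixed_point_b4_iff)
      next
        case odd: False
        then obtain k where "n = 2 * k + 1" by (rule oddE)
        with w show ?thesis by (simp add: fixed_point_b4_iff)
      qed
      with False less[of "n div 2"] show ?thesis
        by (simp add: b4_rec.simps[of n])
    qed
  qed
  then show "w = b4_rec" by blast
qed

lemma b4_0: "b4 0 = L0" and b4_fixed_point: "fixed_point b4_morphism b4"
  using theI'[OF b4_unique_fixed_point] by (simp_all add: b4_def)

end

theory Submission
  imports Defs
begin

text \<open>
  The letters of \<open>b4\<close> are the paperfolding sequence annotated with the parity of the
  position. Given an occurrence \<open>h\<close> of a hybrid formula in \<open>b4\<close>, we build one in the ruler
  word 0102010301020..., whose prefixes, the Zimin words, are unavoidable. If all images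
  have even length, they can be halved by pulling \<open>b4\<close> back along its morphism. Otherwise
  some image has odd length, and any such variable \<open>D\<close> starts and ends at the same parity,
  so it may be mapped to the letter 0, which occupies every second position of the ruler
  word; the other variables are treated by induction. This works unless \<open>D\<close> is the middle
  of a fragment \<open>XDX\<close>, and a suitable \<open>D\<close> exists because the relation "\<open>uvu\<close> is a factor
  of \<open>b4\<close>" has no cycles. Halving reduces the latter to cycles through a single letter, and
  starting from a letter the antisymmetry of the paperfolding sequence about multiples of
  powers of two forces the lengths along the relation to increase strictly.
\<close>

section \<open>Factors at given positions\<close>

definition occurs_at :: "'a list \<Rightarrow> 'a word \<Rightarrow> nat \<Rightarrow> bool" where
  "occurs_at u w s \<longleftrightarrow> u = w [s \<rightarrow> s + length u]"

lemma occurs_at_iff: "occurs_at u w s \<longleftrightarrow> (\<forall>i<length u. u ! i = w (s + i))"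
  unfolding occurs_at_def list_eq_iff_nth_eq[of u "w [s \<rightarrow> s + length u]"] by simp

lemma factor_iff: "factor u w \<longleftrightarrow> (\<exists>s. occurs_at u w s)"
proof
  assume "factor u w"
  then obtain i j where "u = w [i \<rightarrow> j]" by (auto simp: factor_def)
  then have "occurs_at u w i" by (simp add: occurs_at_iff)
  then show "\<exists>s. occurs_at u w s" ..
qed (auto simp: factor_def occurs_at_def)

lemma occurs_at_append:
  "occurs_at (u @ v) w s \<longleftrightarrow> occurs_at u w s \<and> occurs_at v w (s + length u)"
proof -
  have "w [s \<rightarrow> s + length (u @ v)] =
      w [s \<rightarrow> s + length u] @ w [s + length u \<rightarrow> s + length u + length v]"
    using upt_add_eq_append[of s "s + length u" "length v"]
    by (simp add: subsequence_def add.assoc)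
  then show ?thesis by (simp add: occurs_at_def)
qed

lemma occurs_at_Nil [simp]: "occurs_at [] w s"
  by (simp add: occurs_at_iff)

lemma occurs_at_Cons:
  "occurs_at (x # u) w s \<longleftrightarrow> x = w s \<and> occurs_at u w (Suc s)"
  using occurs_at_append[of "[x]" u w s] by (simp add: occurs_at_iff[of "[x]"])

lemma occurs_at_subsequence [simp]: "occurs_at (w [i \<rightarrow> j]) w i"
  by (simp add: occurs_at_iff)

lemma morph_simps [simp]:
  "morph h [] = []" "morph h (x # u) = h x @ morph h u"
  "morph h (u @ v) = morph h u @ morph h v"
  by (simp_all add: morph_def)

section \<open>The ruler word\<close>

text \<open>The value at \<open>n\<close> is the 2-adic valuation of \<open>n + 1\<close>: indices
  start at 0, so the zeros sit at the even positions.\<close>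

function ruler :: "nat word" where
  "ruler n = (if even n then 0 else Suc (ruler (n div 2)))"
  by auto
termination
  by (relation "measure id") (auto elim: oddE)

declare ruler.simps [simp del]

lemma ruler_even [simp]: "ruler (2 * n) = 0"
  and ruler_odd [simp]: "ruler (Suc (2 * n)) = Suc (ruler n)"
  by (simp_all add: ruler.simps[of "2 * n"] ruler.simps[of "Suc (2 * n)"])

text \<open>The ruler word is fixed by this doubling morphism, so spreading a factor doubles its
  position.\<close>

definition spread :: "nat list \<Rightarrow> nat list" where
  "spread u = morph (\<lambda>x. [0, Suc x]) u"

lemma length_spread [simp]: "length (spread u) = 2 * length u"
  by (induction u) (auto simp: spread_def)

lemma occurs_at_spread: "occurs_at u ruler s \<Longrightarrow> occurs_at (spread u) ruler (2 * s)"
proof (induction u arbitrary: s)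
  case (Cons x u)
  then have "x = ruler s" "occurs_at (spread u) ruler (2 * Suc s)"
    using Cons.IH[of "Suc s"] by (simp_all add: occurs_at_Cons)
  then show ?case by (simp add: spread_def occurs_at_Cons)
qed (simp add: spread_def)

fun zimin :: "nat \<Rightarrow> nat list" where
  "zimin 0 = []"
| "zimin (Suc n) = zimin n @ n # zimin n"

lemma spread_zimin: "spread (zimin n) @ [0] = zimin (Suc n)"
proof (induction n)
  case (Suc n)
  have "spread (zimin (Suc n)) @ [0] = (spread (zimin n) @ [0]) @ Suc n # spread (zimin n) @ [0]"
    by (simp add: spread_def)
  with Suc show ?case by simp
qed (simp add: spread_def)

lemma occurs_at_zimin: "occurs_at (zimin n) ruler 0"
proof (induction n)
  case (Suc n)
  then have "occurs_at (spread (zimin n) @ [0]) ruler 0"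
    using occurs_at_spread[of "zimin n" 0] by (simp add: occurs_at_append occurs_at_Cons)
  then show ?case by (simp only: spread_zimin)
qed simp

lemma length_zimin: "n \<le> length (zimin n)"
  by (induction n) auto

lemma zimin_letter_less: "x \<in> set (zimin n) \<Longrightarrow> x < n"
  by (induction n) (auto simp: less_Suc_eq)

section \<open>Unavoidability of the Zimin words\<close>

lemma morph_cong: "(\<And>x. x \<in> set u \<Longrightarrow> h x = g x) \<Longrightarrow> morph h u = morph g u"
  by (induction u) auto

lemma morph_morph: "morph k (morph g u) = morph (\<lambda>x. morph k (g x)) u"
  by (induction u) auto

text \<open>The Zimin words are prefixes of the ruler word of unbounded length. The bound covers
  every later \<open>n\<close>, so that finitely many fragments fit into one Zimin word.\<close>

lemma factor_ruler_in_zimin: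
  assumes "factor u ruler"
  shows "\<exists>N. \<forall>n\<ge>N. \<exists>a b. zimin n = a @ u @ b"
proof -
  obtain s where s: "occurs_at u ruler s" using assms by (auto simp: factor_iff)
  have "\<exists>a b. zimin n = a @ u @ b" if "s + length u \<le> n" for n
  proof -
    have le: "s + length u \<le> length (zimin n)" using that length_zimin[of n] by simp
    define z where "z = zimin n"
    have z: "occurs_at z ruler 0" using occurs_at_zimin by (simp add: z_def)
    have split: "z = take s z @ take (length u) (drop s z) @ drop (length u) (drop s z)"
      by (simp only: append_take_drop_id)
    have "take (length u) (drop s z) = u"
      using s z le by (auto simp: occurs_at_iff list_eq_iff_nth_eq z_def)
    then show ?thesis using split unfolding z_def by metis
  qed
  then show ?thesis by blast
qed

text \<open>Pigeonhole on disjoint windows of length \<open>N\<close>: two of them carry the same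
  word, so an image of \<open>zimin n\<close> in the first recurs in the second, and the gap between
  the copies becomes the image of the new letter. The window bound, uniform in \<open>s\<close>, is
  what makes the induction go through.\<close>

lemma zimin_unavoidable:
  fixes w :: "'a word"
  assumes fin: "finite (range w)"
  shows "\<exists>N. \<forall>s. \<exists>k t. non_erasing k \<and> s \<le> t \<and> t + length (morph k (zimin n)) \<le> s + N
    \<and> occurs_at (morph k (zimin n)) w t"
proof (induction n)
  case 0
  have "non_erasing (\<lambda>x::nat. [w 0])" by (simp add: non_erasing_def)
  then show ?case by (intro exI[of _ 0]) auto
next
  case (Suc n)
  then obtain N where N: "\<forall>s. \<exists>k t. non_erasing k \<and> s \<le> t
    \<and> t + length (morph k (zimin n)) \<le> s + N \<and> occurs_at (morph k (zimin n)) w t" by blast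
  define B where "B = {xs. set xs \<subseteq> range w \<and> length xs = N}"
  have finB: "finite B" unfolding B_def using finite_lists_length_eq[OF fin] by simp
  define M where "M = card B"
  show ?case
  proof (intro exI[of _ "Suc N * Suc M"] allI)
    fix s
    \<comment> \<open>Spacing \<open>Suc N\<close> rather than \<open>N\<close> separates the
      windows by a letter, so the image of \<open>n\<close> is non-empty.\<close>
    define st where "st j = s + Suc N * j" for j
    define blk where "blk j = w [st j \<rightarrow> st j + N]" for j
    have "blk ` {..M} \<subseteq> B" by (auto simp: blk_def B_def subsequence_def)
    then have "card (blk ` {..M}) \<le> M" using card_mono[OF finB] by (simp add: M_def)
    then have "\<not> inj_on blk {..M}" by (auto dest: card_image)
    then obtain i j where ij: "i < j" "j \<le> M" "blk i = blk j"
      unfolding inj_on_def by (metis atMost_iff linorder_neqE_nat)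
    obtain k t where k: "non_erasing k" "st i \<le> t"
        "t + length (morph k (zimin n)) \<le> st i + N" "occurs_at (morph k (zimin n)) w t"
      using N by blast
    let ?u = "morph k (zimin n)"
    define e where "e = t + length ?u"
    define t' where "t' = st j + (t - st i)"
    have stij: "st i + Suc N \<le> st j"
    proof -
      have "Suc N * Suc i \<le> Suc N * j" using ij by (intro mult_le_mono2) simp
      then show ?thesis by (simp add: st_def)
    qed
    have stM: "st j + N \<le> s + Suc N * Suc M"
    proof -
      have "Suc N * j \<le> Suc N * M" using ij by (intro mult_le_mono2) simp
      then show ?thesis by (simp add: st_def)
    qed
    have et': "e < t'" using k stij by (simp add: e_def t'_def)
    have same: "w (st i + x) = w (st j + x)" if "x < N" for x
      using arg_cong[OF ij(3), of "\<lambda>l. l ! x"] that by (simp add: blk_def)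
    have u': "occurs_at ?u w t'"
      unfolding occurs_at_iff
    proof (intro allI impI)
      fix x assume x: "x < length ?u"
      have "w (t + x) = w (st i + (t - st i + x))" using k by simp
      also have "\<dots> = w (st j + (t - st i + x))" using k x by (intro same) linarith
      finally show "?u ! x = w (t' + x)" using k(4) x by (simp add: occurs_at_iff t'_def add.assoc)
    qed
    define k' where "k' = k(n := w [e \<rightarrow> t'])"
    have "non_erasing k'" using k(1) et' by (auto simp: non_erasing_def k'_def subsequence_def)
    moreover have m: "morph k' (zimin (Suc n)) = ?u @ w [e \<rightarrow> t'] @ ?u"
    proof -
      have "morph k' (zimin n) = ?u"
        using zimin_letter_less[of _ n] by (intro morph_cong) (auto simp: k'_def)
      then show ?thesis by (simp add: k'_def)
    qed
    moreover have "occurs_at (morph k' (zimin (Suc n))) w t"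
      using k(4) u' et' unfolding m by (simp add: occurs_at_append e_def)
    moreover have "s \<le> t" using k(2) by (simp add: st_def)
    moreover have "t + length (morph k' (zimin (Suc n))) \<le> s + Suc N * Suc M"
    proof -
      have "t + length (morph k' (zimin (Suc n))) = t' + length ?u"
        unfolding m using et' by (simp add: e_def)
      also have "\<dots> \<le> st j + N" using k by (simp add: t'_def)
      finally show ?thesis using stM by simp
    qed
    ultimately show "\<exists>k t. non_erasing k \<and> s \<le> t
      \<and> t + length (morph k (zimin (Suc n))) \<le> s + Suc N * Suc M
      \<and> occurs_at (morph k (zimin (Suc n))) w t" by blast
  qed
qed

text \<open>A single Zimin word contains the images of all fragments and is unavoidable over a
  finite alphabet; composing the two morphisms gives an occurrence of \<open>f\<close>.\<close>

lemma not_avoidable_if_occurrence_ruler: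
  assumes fin: "finite f" and occ: "occurrence g f ruler"
  shows "\<not> avoidable f"
proof
  assume "avoidable f"
  then obtain w :: "nat word" where w: "finite (range w)" "avoids w f"
    by (auto simp: avoidable_def)
  have "\<forall>\<phi>\<in>f. \<exists>N. \<forall>n\<ge>N. \<exists>a b. zimin n = a @ morph g \<phi> @ b"
    using occ factor_ruler_in_zimin by (auto simp: occurrence_def)
  then obtain N where N: "\<And>\<phi> n. \<phi> \<in> f \<Longrightarrow> n \<ge> N \<phi> \<Longrightarrow> \<exists>a b. zimin n = a @ morph g \<phi> @ b"
    by metis
  define n where "n = Max (insert 0 (N ` f))"
  have n: "N \<phi> \<le> n" if "\<phi> \<in> f" for \<phi> using that fin by (auto simp: n_def)
  obtain k t where k: "non_erasing k" "occurs_at (morph k (zimin n)) w t"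
    using zimin_unavoidable[OF w(1), of n] by blast
  have "occurrence (\<lambda>x. morph k (g x)) f w"
    unfolding occurrence_def
  proof (intro conjI ballI)
    have "morph k u \<noteq> []" if "u \<noteq> []" for u
      using that k(1) by (cases u) (auto simp: non_erasing_def)
    then show "non_erasing (\<lambda>x. morph k (g x))"
      using occ by (auto simp: non_erasing_def occurrence_def)
  next
    fix \<phi> assume "\<phi> \<in> f"
    then obtain a b where "zimin n = a @ morph g \<phi> @ b" using N n by blast
    then have "occurs_at (morph k (morph g \<phi>)) w (t + length (morph k a))"
      using k(2) by (simp add: occurs_at_append)
    then show "factor (morph (\<lambda>x. morph k (g x)) \<phi>) w"
      by (auto simp: factor_iff morph_morph)
  qed
  with w(2) show False by (auto simp: avoids_def)
qed

section \<open>The word b4 as an annotated paperfolding word\<close>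

text \<open>
  A letter of \<open>b4\<close> is the parity of its position together with a letter of the
  paperfolding sequence.
\<close>

definition fold_bit :: "letter \<Rightarrow> bool" where
  "fold_bit x \<longleftrightarrow> x \<in> {L2, L3}"

definition odd_letter :: "letter \<Rightarrow> bool" where
  "odd_letter x \<longleftrightarrow> x \<in> {L1, L3}"

lemma letter_eq_iff: "x = y \<longleftrightarrow> fold_bit x = fold_bit y \<and> odd_letter x = odd_letter y"
  by (cases x; cases y) (auto simp: fold_bit_def odd_letter_def)

lemma b4_double:
  "b4 (2 * n) = b4_morphism (b4 n) ! 0" "b4 (Suc (2 * n)) = b4_morphism (b4 n) ! 1"
  using b4_fixed_point by (simp_all add: fixed_point_b4_iff)

lemma odd_letter_b4 [simp]: "odd_letter (b4 n) \<longleftrightarrow> odd n"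
proof (cases "even n")
  case True
  then obtain m where "n = 2 * m" by blast
  then show ?thesis by (cases "b4 m") (auto simp: b4_double odd_letter_def)
next
  case False
  then obtain m where "n = Suc (2 * m)" by (auto elim: oddE)
  then show ?thesis by (cases "b4 m") (auto simp: b4_double odd_letter_def)
qed

text \<open>The regular paperfolding sequence: at \<open>2 ^ k * Suc (2 * m)\<close> its value is
  the parity of \<open>m\<close>.\<close>

definition pf :: "nat \<Rightarrow> bool" where
  "pf n \<longleftrightarrow> fold_bit (b4 n)"

lemma pf_double [simp]: "pf (2 * n) \<longleftrightarrow> pf n"
  by (cases "b4 n") (auto simp: pf_def b4_double fold_bit_def)

lemma pf_odd [simp]: "pf (Suc (2 * n)) \<longleftrightarrow> odd n"
  using odd_letter_b4[of n]
  by (cases "b4 n") (auto simp: pf_def b4_double fold_bit_def odd_letter_def)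

lemma b4_eq_iff: "b4 m = b4 n \<longleftrightarrow> pf m = pf n \<and> even m = even n"
  by (simp add: letter_eq_iff pf_def)

lemma pf_power_mult [simp]: "pf (2 ^ k * n) \<longleftrightarrow> pf n"
  by (induction k) (simp_all add: mult.assoc)

text \<open>Halving \<open>p\<close> and \<open>x\<close> while \<open>x\<close> is even reduces to
  odd \<open>x = Suc (2 * y)\<close>. With \<open>p = 2 * q\<close>, the values are then the
  parities of \<open>q + y\<close> and \<open>q - y - 1\<close>, whose sum is odd.\<close>

lemma pf_antisymmetric:
  assumes "2 ^ k dvd p" "0 < x" "x < 2 ^ k" "x \<le> p"
  shows "pf (p + x) \<noteq> pf (p - x)"
  using assms
proof (induction k arbitrary: p x)
  case (Suc k)
  obtain q where q: "p = 2 * q" "2 ^ k dvd q" using Suc.prems(1) by (auto elim!: dvdE)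
  show ?case
  proof (cases "even x")
    case True
    then obtain y where y: "x = 2 * y" by blast
    have "pf (q + y) \<noteq> pf (q - y)" using Suc.prems q y by (intro Suc.IH) auto
    moreover have "p + x = 2 * (q + y)" "p - x = 2 * (q - y)" using q y by auto
    ultimately show ?thesis by (metis pf_double)
  next
    case False
    then obtain y where y: "x = Suc (2 * y)" by (auto elim: oddE)
    have lt: "y < q" using q y Suc.prems by simp
    have "p + x = Suc (2 * (q + y))" "p - x = Suc (2 * (q - y - 1))" using lt q y by auto
    moreover have "odd (q + y) \<noteq> odd (q - y - 1)" using lt by presburger
    ultimately show ?thesis by (metis pf_odd)
  qed
qed simp

section \<open>2-adic valuations and the positions of equal factors\<close>

text \<open>A residue condition expresses the 2-adic valuation: it is visibly invariant under shifts
  by multiples of \<open>2 ^ Suc k\<close>, and it fails for \<open>n = 0\<close>.\<close>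

definition val :: "nat \<Rightarrow> nat \<Rightarrow> bool" where
  "val n k \<longleftrightarrow> n mod 2 ^ Suc k = 2 ^ k"

lemma val_iff: "val n k \<longleftrightarrow> (\<exists>m. n = 2 ^ k * Suc (2 * m))"
proof
  assume "val n k"
  then have "n = 2 ^ Suc k * (n div 2 ^ Suc k) + 2 ^ k"
    using mult_div_mod_eq[of "2 ^ Suc k" n] by (simp add: val_def)
  then have "n = 2 ^ k * Suc (2 * (n div 2 ^ Suc k))" by (simp add: algebra_simps)
  then show "\<exists>m. n = 2 ^ k * Suc (2 * m)" ..
next
  assume "\<exists>m. n = 2 ^ k * Suc (2 * m)"
  then obtain m where "n = 2 ^ Suc k * m + 2 ^ k" by (auto simp: algebra_simps)
  then show "val n k" by (simp add: val_def)
qed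

text \<open>Such an interval meets every residue class modulo \<open>2 ^ Suc k\<close>.\<close>

lemma val_in_interval:
  assumes "2 ^ Suc k \<le> l"
  shows "\<exists>i<l. val (s + i) k"
proof -
  define y where "y = (2::nat) ^ k"
  define x where "x = s mod (2 * y)"
  have y: "0 < y" by (simp add: y_def)
  then have x: "x < 2 * y" by (simp add: x_def)
  define i where "i = (if x \<le> y then y - x else 3 * y - x)"
  have "i < 2 * y" using x y by (auto simp: i_def)
  moreover have "(x + i) mod (2 * y) = y"
  proof (cases "x \<le> y")
    case True
    then have "x + i = y" by (simp add: i_def)
    then show ?thesis using y by simp
  next
    case False
    then have "x + i = y + 2 * y" using x by (simp add: i_def)
    then show ?thesis using y by (simp only: mod_add_self2) simp
  qed
  then have "(s + i) mod (2 * y) = y" unfolding x_def by (simp only: mod_add_left_eq)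
  then have "val (s + i) k" by (simp add: val_def y_def)
  ultimately show ?thesis using assms unfolding y_def by (intro exI[of _ i]) simp
qed

lemma val_not_large: "n < 2 ^ k \<Longrightarrow> \<not> val n k"
  by (auto simp: val_def)

text \<open>
  The letter at a position of valuation \<open>j\<close> determines that position modulo
  \<open>2 ^ (j + 2)\<close>, once it is known modulo \<open>2 ^ (j + 1)\<close>.
\<close>

lemma shift_dvd:
  assumes same: "\<And>i. i < l \<Longrightarrow> b4 (s + i) = b4 (s + d + i)" and l: "0 < l"
    and vals: "\<And>j. j < m \<Longrightarrow> \<exists>i<l. val (s + i) j \<or> val (s + d + i) j"
  shows "2 ^ Suc m dvd d"
  using vals
proof (induction m)
  case 0
  show ?case using same[OF l] by (auto simp: b4_eq_iff)
next
  case (Suc m)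
  then have dvd: "2 ^ Suc m dvd d" by simp
  then obtain e where e: "d = 2 ^ m * (2 * e)" by (auto elim!: dvdE)
  obtain i where i: "i < l" "val (s + i) m \<or> val (s + d + i) m" using Suc.prems by blast
  have "(s + d + i) mod 2 ^ Suc m = (s + i + d) mod 2 ^ Suc m" by (simp add: ac_simps)
  also have "\<dots> = (s + i) mod 2 ^ Suc m"
    using dvd by (metis add.right_neutral mod_0_imp_dvd mod_add_right_eq dvd_imp_mod_0)
  finally have "val (s + i) m" using i(2) by (auto simp: val_def)
  then obtain n where n: "s + i = 2 ^ m * Suc (2 * n)" by (auto simp: val_iff)
  then have "s + d + i = 2 ^ m * Suc (2 * (n + e))" using e by (simp add: algebra_simps)
  then have "odd n = odd (n + e)"
    using same[OF i(1)] n by (metis b4_eq_iff pf_power_mult pf_odd)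
  then have "even e" by auto
  then show ?case using e by (auto elim!: evenE)
qed

text \<open>\<open>shift_dvd\<close> is applied from the smaller position. Its hypothesis accepts a
  valuation seen at either end of the shift, so the valuations around \<open>s\<close> suffice in
  both cases.\<close>

lemma occurrences_congruent:
  assumes s: "occurs_at u b4 s" and t: "occurs_at u b4 t" and u: "u \<noteq> []"
    and vals: "\<And>j. j < m \<Longrightarrow> \<exists>i<length u. val (s + i) j"
  shows "s mod 2 ^ Suc m = t mod 2 ^ Suc m"
proof (cases "s \<le> t")
  case True
  then obtain d where d: "t = s + d" by (auto dest: le_Suc_ex)
  have "2 ^ Suc m dvd d"
  proof (rule shift_dvd[of "length u" s])
    show "b4 (s + i) = b4 (s + d + i)" if "i < length u" for i
      using s t that unfolding d occurs_at_iff by metis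
  qed (use u vals in auto)
  then show ?thesis using d by (auto elim!: dvdE)
next
  case False
  then obtain d where d: "s = t + d" by (metis le_Suc_ex nat_le_linear)
  have "2 ^ Suc m dvd d"
  proof (rule shift_dvd[of "length u" t])
    show "b4 (t + i) = b4 (t + d + i)" if "i < length u" for i
      using s t that unfolding d occurs_at_iff by metis
  qed (use u vals d in auto)
  then show ?thesis using d by (auto elim!: dvdE)
qed

section \<open>Halving the factors of b4\<close>

text \<open>
  A factor of length at least 2 determines its position modulo 4, so the letters at
  even positions can be pulled back along the morphism in a well-defined way.
\<close>

definition halve :: "letter list \<Rightarrow> letter list" where
  "halve u = (let s = SOME s. occurs_at u b4 s
    in (b4 [(s + 1) div 2 \<rightarrow> (s + length u + 1) div 2]))"

text \<open>The choice in \<open>halve\<close> is harmless: two occurrences of a word of length at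
  least 2 agree modulo 4, so the halved positions agree modulo 2, and
  \<open>pf (2 * n) = pf n\<close> transfers the paperfolding part.\<close>

lemma halve_eq:
  assumes s: "occurs_at u b4 s" and u: "2 \<le> length u"
  shows "halve u = b4 [(s + 1) div 2 \<rightarrow> (s + length u + 1) div 2]"
proof -
  define t where "t = (SOME s. occurs_at u b4 s)"
  have t: "occurs_at u b4 t" unfolding t_def using s by (rule someI)
  have "s mod 2 ^ Suc 1 = t mod 2 ^ Suc 1"
    using s t u val_in_interval[of 0 "length u" s] by (intro occurrences_congruent) auto
  then have "s mod 4 = t mod 4" by simp
  then obtain r x y where s_eq: "s = 4 * x + r" and t_eq: "t = 4 * y + r"
    by (metis mult_div_mod_eq)
  define lo where "lo = (r + 1) div 2"
  define hi where "hi = (r + length u + 1) div 2"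
  have "b4 [2 * y + lo \<rightarrow> 2 * y + hi] = b4 [2 * x + lo \<rightarrow> 2 * x + hi]"
  proof (rule nth_equalityI)
    fix i assume "i < length (b4 [2 * y + lo \<rightarrow> 2 * y + hi])"
    then have i: "i < hi - lo" by simp
    \<comment> \<open>The offset in \<open>u\<close> of the letter lying over the
      \<open>i\<close>-th halved letter; \<open>r \<le> 2 * lo\<close> makes the subtraction
      exact.\<close>
    define j where "j = 2 * (lo + i) - r"
    have lo: "r \<le> 2 * lo" unfolding lo_def by linarith
    have "2 * hi \<le> r + length u + 1" unfolding hi_def by linarith
    moreover have "lo + i + 1 \<le> hi" using i by linarith
    moreover have "j + r = 2 * (lo + i)" using lo by (simp add: j_def)
    ultimately have j: "j < length u" by presburger
    have jt: "t + j = 2 * (2 * y + lo + i)" and js: "s + j = 2 * (2 * x + lo + i)"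
      using lo by (simp_all add: j_def s_eq t_eq)
    have "pf (t + j) = pf (s + j)"
      using s t j unfolding occurs_at_iff pf_def by metis
    then have "pf (2 * y + lo + i) = pf (2 * x + lo + i)" unfolding jt js pf_double .
    then have "b4 (2 * y + lo + i) = b4 (2 * x + lo + i)" by (simp add: b4_eq_iff)
    then show "b4 [2 * y + lo \<rightarrow> 2 * y + hi] ! i = b4 [2 * x + lo \<rightarrow> 2 * x + hi] ! i"
      using i by simp
  qed simp
  moreover have "(s + 1) div 2 = 2 * x + lo" "(s + length u + 1) div 2 = 2 * x + hi"
    "(t + 1) div 2 = 2 * y + lo" "(t + length u + 1) div 2 = 2 * y + hi"
    unfolding s_eq t_eq lo_def hi_def by linarith+
  ultimately show ?thesis by (simp add: halve_def Let_def flip: t_def)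
qed

text \<open>Start and end are both rounded up, so adjacent factors halve to adjacent factors. A
  factor of length at least 2 covers an even and an odd position, hence shrinks without
  vanishing.\<close>

lemma
  assumes "occurs_at u b4 s" and "2 \<le> length u"
  shows occurs_at_halve: "occurs_at (halve u) b4 ((s + 1) div 2)"
    and end_halve: "(s + 1) div 2 + length (halve u) = (s + length u + 1) div 2"
    and length_halve: "length (halve u) < length u" "halve u \<noteq> []"
proof -
  note eq = halve_eq[OF assms]
  show "occurs_at (halve u) b4 ((s + 1) div 2)" by (simp add: eq)
  have len: "length (halve u) = (s + length u + 1) div 2 - (s + 1) div 2" by (simp add: eq)
  then show "(s + 1) div 2 + length (halve u) = (s + length u + 1) div 2" by simp
  show "length (halve u) < length u" using len assms(2) by linarith
  have "0 < length (halve u)" using len assms(2) by linarith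
  then show "halve u \<noteq> []" by simp
qed

lemma occurs_at_morph_halve:
  assumes "occurs_at (morph h \<phi>) b4 s" and "\<And>x. x \<in> set \<phi> \<Longrightarrow> 2 \<le> length (h x)"
  shows "occurs_at (morph (\<lambda>x. halve (h x)) \<phi>) b4 ((s + 1) div 2)"
  using assms
proof (induction \<phi> arbitrary: s)
  case (Cons x \<phi>)
  have x: "occurs_at (h x) b4 s" "2 \<le> length (h x)"
    using Cons.prems by (auto simp: occurs_at_append)
  have "occurs_at (morph (\<lambda>x. halve (h x)) \<phi>) b4 ((s + length (h x) + 1) div 2)"
    using Cons.prems by (intro Cons.IH) (auto simp: occurs_at_append)
  then show ?case
    using occurs_at_halve[OF x] end_halve[OF x] by (simp add: occurs_at_append)
qed simp

section \<open>Acyclicity of the return relation\<close>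

text \<open>The half-length is small compared with the power of two dividing the middle position, so
  \<open>pf\<close> is antisymmetric about the middle even beyond the ends of \<open>v\<close>. A
  letter at an even position is the case \<open>a = k = 0\<close>.\<close>

definition centered :: "letter list \<Rightarrow> bool" where
  "centered v \<longleftrightarrow> (\<exists>k a. length v = 2 * a + 1 \<and> a < 2 ^ k
    \<and> (\<forall>t. occurs_at v b4 t \<longrightarrow> 2 ^ Suc k dvd t + a))"

text \<open>Positions below \<open>2 ^ m\<close> never have valuation \<open>m\<close>, so some
  valuation is missing from the interval; the least one is taken.\<close>

lemma val_missing:
  obtains m where "\<And>i. i < l \<Longrightarrow> \<not> val (s + i) m" and "\<And>j. j < m \<Longrightarrow> \<exists>i<l. val (s + i) j"
proof -
  let ?P = "\<lambda>m. \<forall>i<l. \<not> val (s + i) m"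
  have lt: "s + l < 2 ^ (s + l)" by simp
  have "?P (s + l)"
    by (intro allI impI val_not_large) (use lt in linarith)
  then have "?P (LEAST m. ?P m)" by (rule LeastI)
  moreover have "\<not> ?P j" if "j < (LEAST m. ?P m)" for j using that by (rule not_less_Least)
  ultimately show ?thesis using that by blast
qed

lemma even_return_length:
  assumes "occurs_at (u @ v @ u) b4 s" "u \<noteq> []"
  shows "even (length u + length v)"
proof -
  have "occurs_at u b4 s" "occurs_at u b4 (s + length u + length v)"
    using assms by (auto simp: occurs_at_append add.assoc)
  then have "b4 s = b4 (s + length u + length v)"
    using assms(2) unfolding occurs_at_iff by (metis add.right_neutral length_greater_0_conv)
  then have "even s = even (s + length u + length v)" by (simp only: b4_eq_iff)
  then show ?thesis by auto
qed

text \<open>The valuations below \<open>m\<close> force the shift to be a multiple of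
  \<open>2 ^ Suc m\<close>. A stretch of that length contains a position of valuation
  \<open>m\<close>, which must fall inside \<open>v\<close>.\<close>

lemma return_val_missing:
  assumes occ: "occurs_at (u @ v @ u) b4 s" and u: "u \<noteq> []"
    and no: "\<And>i. i < length u \<Longrightarrow> \<not> val (s + i) m"
    and vals: "\<And>j. j < m \<Longrightarrow> \<exists>i<length u. val (s + i) j"
  shows "2 ^ Suc m dvd length u + length v"
    and "\<exists>i<length v. val (s + length u + i) m"
proof -
  define d where "d = length u + length v"
  have d: "0 < d" using u by (simp add: d_def)
  have 1: "occurs_at u b4 s" and 2: "occurs_at u b4 (s + d)"
    using occ by (auto simp: occurs_at_append add.assoc d_def)
  have dvd: "2 ^ Suc m dvd d"
  proof (rule shift_dvd[of "length u" s])
    show "b4 (s + i) = b4 (s + d + i)" if "i < length u" for i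
      using 1 2 that unfolding occurs_at_iff by metis
  qed (use u vals in auto)
  then show "2 ^ Suc m dvd length u + length v" by (simp add: d_def)
  have "2 ^ Suc m \<le> d" using dvd d by (rule dvd_imp_le)
  then obtain i where i: "i < d" "val (s + i) m" using val_in_interval by blast
  then have "length u \<le> i" using no by (meson not_le)
  then show "\<exists>i<length v. val (s + length u + i) m"
    using i by (intro exI[of _ "i - length u"]) (auto simp: d_def)
qed

text \<open>The least valuation missing from \<open>u\<close> must appear at the odd position of
  \<open>v\<close>, so it is 0; then \<open>u\<close> covers no odd position.\<close>

lemma return_of_odd_letter:
  assumes occ: "occurs_at (u @ v @ u) b4 s" and u: "u \<noteq> []"
    and v: "length v = 1" "odd (s + length u)"
  shows "length u = 1"
proof -
  obtain m where m: "\<And>i. i < length u \<Longrightarrow> \<not> val (s + i) m"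
      "\<And>j. j < m \<Longrightarrow> \<exists>i<length u. val (s + i) j"
    using val_missing[of "length u" s] by blast
  have "val (s + length u) m" using return_val_missing(2)[OF occ u m] v by auto
  then obtain n where "s + length u = 2 ^ m * Suc (2 * n)" by (auto simp: val_iff)
  then have "m = 0" using v(2) by (cases m) (auto simp del: even_add)
  then have "\<not> 2 \<le> length u" using val_in_interval[of 0 "length u" s] m(1) by auto
  moreover have "0 < length u" using u by simp
  ultimately show ?thesis by linarith
qed

text \<open>The middles of the two copies of \<open>u\<close> carry equal letters at mirror
  positions about the middle \<open>p\<close> of \<open>v\<close>, so antisymmetry makes
  \<open>u\<close> long. The least valuation missing from \<open>u\<close> can then appear in
  \<open>v\<close> only at \<open>p\<close>, which places the middle of \<open>u\<close> at
  \<open>p - 2 ^ m\<close>, a multiple of \<open>2 ^ Suc m\<close>.\<close>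

lemma return_of_centered:
  assumes occ: "occurs_at (u @ v @ u) b4 s" and u: "u \<noteq> []" and v: "centered v"
  shows "centered u \<and> length v < length u"
proof -
  define l where "l = length u"
  obtain k a where ka: "length v = 2 * a + 1" "a < 2 ^ k"
      "\<And>t. occurs_at v b4 t \<Longrightarrow> 2 ^ Suc k dvd t + a"
    using v unfolding centered_def by blast
  define p where "p = s + l + a"
  have "s + length u + length v = p + a + 1" using ka(1) by (simp add: p_def l_def)
  then have vp: "occurs_at v b4 (s + l)" and u1: "occurs_at u b4 s"
    and u2: "occurs_at u b4 (p + a + 1)"
    using occ by (simp_all add: occurs_at_append l_def)
  have p: "2 ^ Suc k dvd p" using ka(3)[OF vp] by (simp add: p_def)
  have "odd l" using even_return_length[OF occ u] ka(1) by (simp add: l_def)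
  then obtain c where c: "l = 2 * c + 1" by (rule oddE)
  have long: "2 ^ Suc k \<le> a + 1 + c"
  proof (rule ccontr)
    assume "\<not> ?thesis"
    then have "pf (p + (a + 1 + c)) \<noteq> pf (p - (a + 1 + c))"
      using p c by (intro pf_antisymmetric[of "Suc k"]) (auto simp: p_def)
    moreover have "p + (a + 1 + c) = p + a + 1 + c" "p - (a + 1 + c) = s + c"
      using c by (auto simp: p_def)
    moreover have "b4 (p + a + 1 + c) = b4 (s + c)"
    proof -
      have "c < length u" using c by (simp add: l_def)
      then have "u ! c = b4 (s + c)" "u ! c = b4 (p + a + 1 + c)"
        using u1 u2 unfolding occurs_at_iff by blast+
      then show ?thesis by simp
    qed
    ultimately show False unfolding pf_def by metis
  qed
  obtain m where m: "\<And>i. i < length u \<Longrightarrow> \<not> val (s + i) m"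
      "\<And>j. j < m \<Longrightarrow> \<exists>i<length u. val (s + i) j"
    using val_missing[of "length u" s] by blast
  have short: "l < 2 ^ Suc m"
    using val_in_interval[of m l s] m(1) by (force simp: l_def)
  have "2 ^ k < (2 ^ Suc m :: nat)" using short long c ka(2) by simp
  then have km: "k \<le> m" by (simp only: power_strict_increasing_iff)
  obtain i where i: "i < length v" "val (s + l + i) m"
    using return_val_missing(2)[OF occ u m] by (auto simp: l_def)
  have "2 ^ k dvd s + l + i"
  proof -
    have "2 ^ m dvd s + l + i" using i(2) by (auto simp: val_iff)
    then show ?thesis using km le_imp_power_dvd dvd_trans by blast
  qed
  moreover have "2 ^ k dvd p" using p by (meson dvd_trans le_imp_power_dvd le_SucI order_refl)
  \<comment> \<open>Subtraction of naturals truncates, so both orders are needed to conclude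
    \<open>i = a\<close>.\<close>
  ultimately have "2 ^ k dvd (s + l + i) - p" "2 ^ k dvd p - (s + l + i)"
    by (simp_all add: dvd_diff_nat)
  then have "2 ^ k dvd i - a" "2 ^ k dvd a - i" by (simp_all add: p_def)
  moreover have "i - a < 2 ^ k" "a - i < 2 ^ k" using i(1) ka(1,2) by linarith+
  ultimately have "i = a" by (metis dvd_imp_le gr0I not_less diffs0_imp_equal)
  then have pm: "val p m" using i(2) by (simp add: p_def)
  have "\<not> m < Suc k"
  proof
    assume "m < Suc k"
    then have "2 ^ Suc m dvd p" using p by (meson Suc_leI dvd_trans le_imp_power_dvd)
    then show False using pm by (simp add: val_def)
  qed
  then have km: "Suc k \<le> m" by simp
  then have pow: "(2::nat) ^ Suc k \<le> 2 ^ m" by (intro power_increasing) auto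
  \<comment> \<open>The sum is a positive multiple of \<open>2 ^ Suc m\<close> and less than twice
    that power.\<close>
  have d: "l + (2 * a + 1) = 2 ^ Suc m"
  proof -
    have "2 ^ Suc m dvd l + (2 * a + 1)"
      using return_val_missing(1)[OF occ u m] ka(1) by (simp add: l_def)
    then obtain q where q: "l + (2 * a + 1) = 2 ^ Suc m * q" by blast
    have "l + (2 * a + 1) < 2 ^ Suc m * 2" using short ka(2) pow by simp
    then have "q < 2" unfolding q by simp
    moreover have "q \<noteq> 0" using q by (cases q) auto
    ultimately show ?thesis using q by (cases q) auto
  qed
  have c': "c + a + 1 = 2 ^ m" using d c by simp
  have "centered u"
    unfolding centered_def
  proof (intro exI conjI allI impI)
    show "length u = 2 * c + 1" using c by (simp add: l_def)
    show "c < 2 ^ m" using c' by simp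
    fix t assume t: "occurs_at u b4 t"
    have "s mod 2 ^ Suc m = t mod 2 ^ Suc m"
      using u1 t u m(2) by (rule occurrences_congruent)
    then have "(t + c) mod 2 ^ Suc m = (s + c) mod 2 ^ Suc m" by (metis mod_add_left_eq)
    moreover have "2 ^ Suc m dvd s + c"
    proof -
      obtain n where n: "p = 2 ^ m * Suc (2 * n)" using pm by (auto simp: val_iff)
      have "s + c + 2 ^ m = p" using c c' by (simp add: p_def)
      then have "s + c = 2 ^ Suc m * n" using n by simp
      then show ?thesis by simp
    qed
    ultimately show "2 ^ Suc m dvd t + c" by (simp only: dvd_eq_mod_eq_0)
  qed
  moreover have "length v < length u"
    using long c ka by (simp add: l_def)
  ultimately show ?thesis ..
qed

lemma centered_even_letter:
  assumes "length v = 1" "occurs_at v b4 s" "even s"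
  shows "centered v"
  unfolding centered_def
proof (intro exI conjI allI impI)
  show "length v = 2 * 0 + 1" using assms by simp
  show "(0::nat) < 2 ^ 0" by simp
  fix t assume "occurs_at v b4 t"
  then have "b4 s = b4 t" using assms by (auto simp: occurs_at_iff)
  then show "2 ^ Suc 0 dvd t + 0" using assms(3) by (simp add: b4_eq_iff)
qed

text \<open>Otherwise every \<open>v\<close> in \<open>S\<close> is enclosed by some
  \<open>u\<close> in \<open>S\<close>. A longest centered \<open>v\<close> would be enclosed by a
  longer centered word, so none is centered and no single letter of \<open>S\<close> sits at an even
  position; a letter at an odd position would be enclosed by such a letter. All lengths are then at
  least 2, and halving \<open>S\<close> gives a smaller counterexample.\<close>

lemma no_return_in_finite:
  assumes "finite S" "S \<noteq> {}" "[] \<notin> S"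
  shows "\<exists>v\<in>S. \<forall>u\<in>S. \<not> factor (u @ v @ u) b4"
proof (rule ccontr)
  assume "\<not> ?thesis"
  then have "\<And>v. v \<in> S \<Longrightarrow> \<exists>u\<in>S. factor (u @ v @ u) b4" by blast
  with assms show False
  proof (induction "\<Sum>u\<in>S. length u" arbitrary: S rule: less_induct)
    case less
    have ret: "\<exists>u\<in>S. \<exists>s. occurs_at (u @ v @ u) b4 s" if "v \<in> S" for v
      using less.prems(4)[OF that] by (auto simp: factor_iff)
    have no_centered: "\<not> centered v" if "v \<in> S" for v
    proof
      assume "centered v"
      define C where "C = {u \<in> S. centered u}"
      have fin: "finite C" and ne: "C \<noteq> {}"
        using less.prems(1) \<open>centered v\<close> that by (auto simp: C_def)
      then obtain x where x: "x \<in> C" "\<And>y. y \<in> C \<Longrightarrow> length y \<le> length x"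
        using Max_in[of "length ` C"] Max_ge[of "length ` C"] by fastforce
      obtain u s where u: "u \<in> S" "occurs_at (u @ x @ u) b4 s"
        using ret[of x] x(1) unfolding C_def by blast
      have "u \<noteq> []" using u(1) less.prems(3) by auto
      then have "centered u \<and> length x < length u"
        using return_of_centered[OF u(2)] x(1) by (auto simp: C_def)
      then show False using x(2)[of u] u(1) by (auto simp: C_def)
    qed
    have no_even_letter: "odd s" if "v \<in> S" "length v = 1" "occurs_at v b4 s" for v s
      using centered_even_letter[OF that(2,3)] no_centered[OF that(1)] by blast
    have long: "2 \<le> length v" if v: "v \<in> S" for v
    proof (rule ccontr)
      assume "\<not> ?thesis"
      moreover have "v \<noteq> []" using v less.prems(3) by auto
      then have "0 < length v" by simp
      ultimately have v1: "length v = 1" by linarith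
      obtain u s where u: "u \<in> S" "occurs_at (u @ v @ u) b4 s" using ret v by blast
      have une: "u \<noteq> []" using u(1) less.prems(3) by auto
      have "occurs_at u b4 s" "occurs_at v b4 (s + length u)"
        using u(2) by (auto simp: occurs_at_append)
      moreover from this have "odd (s + length u)" using no_even_letter v v1 by blast
      moreover from this have "length u = 1" using return_of_odd_letter[OF u(2) une v1] by blast
      ultimately show False using no_even_letter[OF u(1)] by fastforce
    qed
    have occ: "\<exists>s. occurs_at v b4 s" if "v \<in> S" for v
      using ret[OF that] by (auto simp: occurs_at_append)
    have half: "length (halve v) < length v" "halve v \<noteq> []" if "v \<in> S" for v
      using occ[OF that] length_halve long[OF that] by blast+
    show False
    proof (rule less.hyps[of "halve ` S"])
      \<comment> \<open>Distinct words may have the same half, so only an inequality holds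
        here.\<close>
      have "(\<Sum>u\<in>halve ` S. length u) \<le> (\<Sum>u\<in>S. length (halve u))"
        using sum_image_le[of S length halve] less.prems(1) by simp
      also have "\<dots> < (\<Sum>u\<in>S. length u)"
        using less.prems(1,2) half by (intro sum_strict_mono) auto
      finally show "(\<Sum>u\<in>halve ` S. length u) < (\<Sum>u\<in>S. length u)" .
      show "finite (halve ` S)" "halve ` S \<noteq> {}" using less.prems by auto
      show "[] \<notin> halve ` S" using half(2) by force
      fix v' assume "v' \<in> halve ` S"
      then obtain v where v: "v \<in> S" "v' = halve v" by blast
      obtain u s where u: "u \<in> S" "occurs_at (u @ v @ u) b4 s" using ret v(1) by blast
      \<comment> \<open>The words themselves serve as variables, with the identity as
        morphism.\<close>
      have "occurs_at (morph halve [u, v, u]) b4 ((s + 1) div 2)"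
        using occurs_at_morph_halve[of "\<lambda>x. x" "[u, v, u]" s] u v long by auto
      then have "factor (halve u @ v' @ halve u) b4"
        using v(2) by (auto simp: factor_iff)
      then show "\<exists>u\<in>halve ` S. factor (u @ v' @ u) b4" using u(1) by blast
    qed
  qed
qed

section \<open>Transfer of occurrences to the ruler word\<close>

text \<open>For non-empty \<open>u\<close>, \<open>spread u\<close> starts with 0 and, in the ruler
  word, ends just before the next 0; the flags decide whether each boundary 0 belongs to the
  image.\<close>

definition pad :: "bool \<Rightarrow> bool \<Rightarrow> nat list \<Rightarrow> nat list" where
  "pad l r u = (if l then spread u else tl (spread u)) @ (if r then [0] else [])"

text \<open>Starts and ends are twice the original ones plus 0 or 1. Adjacent factors stay adjacent
  when the right flag of the first is the negation of the left flag of the second.\<close>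

lemma
  assumes "occurs_at u ruler i" "u \<noteq> []"
  shows occurs_at_pad: "occurs_at (pad l r u) ruler (2 * i + of_bool (\<not> l))"
    and length_pad: "2 * i + of_bool (\<not> l) + length (pad l r u) = 2 * (i + length u) + of_bool r"
    and pad_nonempty: "pad l r u \<noteq> []"
proof -
  obtain x v where sp: "spread u = 0 # x # v"
    using assms(2) by (cases u) (auto simp: spread_def)
  have occ: "occurs_at (spread u) ruler (2 * i)" using assms(1) by (rule occurs_at_spread)
  have "2 * length u = length v + 2" using arg_cong[OF sp, of length] by simp
  then show len: "2 * i + of_bool (\<not> l) + length (pad l r u) = 2 * (i + length u) + of_bool r"
    by (simp add: pad_def sp)
  have "occurs_at (if l then spread u else tl (spread u)) ruler (2 * i + of_bool (\<not> l))"
    using occ by (auto simp: sp occurs_at_Cons)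
  moreover have "occurs_at [0] ruler (2 * (i + length u))"
    by (simp only: occurs_at_Cons ruler_even occurs_at_Nil simp_thms)
  moreover have "2 * i + of_bool (\<not> l) + length (if l then spread u else tl (spread u))
      = 2 * (i + length u)"
    using len by (simp add: pad_def split: if_splits)
  ultimately show "occurs_at (pad l r u) ruler (2 * i + of_bool (\<not> l))"
    unfolding pad_def occurs_at_append by (metis occurs_at_Nil)
  show "pad l r u \<noteq> []" by (simp add: pad_def sp)
qed

lemma odd_letter_adjacent:
  assumes "occurs_at (u @ v) b4 s" "u \<noteq> []" "v \<noteq> []"
  shows "odd_letter (hd v) \<longleftrightarrow> \<not> odd_letter (last u)"
proof -
  have u: "occurs_at u b4 s" and v: "occurs_at v b4 (s + length u)"
    using assms(1) by (auto simp: occurs_at_append)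
  have "hd v = b4 (s + length u)" using v assms(3) by (simp add: occurs_at_iff hd_conv_nth)
  moreover have "last u = b4 (s + (length u - 1))"
    using u assms(2) by (simp add: occurs_at_iff last_conv_nth)
  moreover have "0 < length u" using assms(2) by simp
  ultimately show ?thesis by (auto simp: gr0_conv_Suc)
qed

lemma odd_length_letters:
  assumes "factor u b4" "odd (length u)"
  shows "odd_letter (last u) = odd_letter (hd u)"
proof -
  obtain s where u: "occurs_at u b4 s" using assms(1) by (auto simp: factor_iff)
  have ne: "u \<noteq> []" using assms(2) by auto
  have "hd u = b4 s" using u ne by (simp add: occurs_at_iff hd_conv_nth)
  moreover have "last u = b4 (s + (length u - 1))"
    using u ne by (simp add: occurs_at_iff last_conv_nth)
  ultimately show ?thesis using assms(2) by simp
qed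

text \<open>
  If \<open>D\<close> has odd length then it starts and ends at positions of the same parity, and
  sending \<open>D\<close> to 0 puts the letters 0 of the ruler word exactly at that parity.
\<close>

lemma insert_variable:
  fixes h :: "'v \<Rightarrow> letter list" and g :: "'v \<Rightarrow> nat list"
  assumes h: "\<And>X. X \<in> V \<Longrightarrow> h X \<noteq> []" and D: "factor (h D) b4" "odd (length (h D))"
    and f: "\<And>\<phi>. \<phi> \<in> f \<Longrightarrow> set \<phi> \<subseteq> V \<and> (\<exists>X Y. \<phi> = [X, Y] \<or> \<phi> = [X, Y, X]) \<and> factor (morph h \<phi>) b4"
    and mid: "\<And>X. [X, D, X] \<notin> f"
    and g: "\<And>X. g X \<noteq> [] \<and> factor (g X) ruler"
    and fg: "\<And>\<phi>. \<phi> \<in> f \<Longrightarrow> D \<notin> set \<phi> \<Longrightarrow> factor (morph g \<phi>) ruler"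
  shows "\<exists>G. (\<forall>X. G X \<noteq> [] \<and> factor (G X) ruler) \<and> (\<forall>\<phi>\<in>f. factor (morph G \<phi>) ruler)"
proof -
  define d where "d = odd_letter (hd (h D))"
  \<comment> \<open>The flags tell whether an image under \<open>h\<close> starts, or ends, at the
    parity of \<open>D\<close>, which is the parity that receives the zeros of the ruler
    word.\<close>
  define l where "l X \<longleftrightarrow> odd_letter (hd (h X)) = d" for X
  define r where "r X \<longleftrightarrow> odd_letter (last (h X)) = d" for X
  define G where "G X = (if X = D then [0] else pad (l X) (r X) (g X))" for X
  have lrD: "l D" "r D" using odd_length_letters[OF D] by (auto simp: l_def r_def d_def)
  have adj: "l Y \<longleftrightarrow> \<not> r X" if "occurs_at (h X @ h Y) b4 s" "X \<in> V" "Y \<in> V" for X Y s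
    using odd_letter_adjacent[OF that(1)] h that(2,3) by (auto simp: l_def r_def)
  have zero: "occurs_at [0] ruler (2 * i)" for i
    by (simp only: occurs_at_Cons ruler_even occurs_at_Nil simp_thms)
  have GD: "G D = [0]" by (simp add: G_def)
  have GX: "occurs_at (G X) ruler (2 * i + of_bool (\<not> l X))"
      "2 * i + of_bool (\<not> l X) + length (G X) = 2 * (i + length (g X)) + of_bool (r X)"
    if "X \<noteq> D" "occurs_at (g X) ruler i" for X i
    using occurs_at_pad[OF that(2)] length_pad[OF that(2)] g that(1) by (simp_all add: G_def)
  have "G X \<noteq> [] \<and> factor (G X) ruler" for X
  proof (cases "X = D")
    case True
    then show ?thesis using zero GD by (auto simp: factor_iff)
  next
    case False
    obtain i where i: "occurs_at (g X) ruler i" using g by (auto simp: factor_iff)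
    then have "G X \<noteq> []" using pad_nonempty[OF i] g False by (simp add: G_def)
    then show ?thesis using GX(1)[OF False i] by (auto simp: factor_iff)
  qed
  moreover have "factor (morph G \<phi>) ruler" if \<phi>: "\<phi> \<in> f" for \<phi>
  proof -
    obtain X Y where XY: "\<phi> = [X, Y] \<or> \<phi> = [X, Y, X]" using f[OF \<phi>] by blast
    have V: "X \<in> V" "Y \<in> V" using f[OF \<phi>] XY by auto
    obtain s where s: "occurs_at (morph h \<phi>) b4 s" using f[OF \<phi>] by (auto simp: factor_iff)
    have 1: "l Y \<longleftrightarrow> \<not> r X" using adj[OF _ V, of s] s XY by (auto simp: occurs_at_append)
    have 2: "l X \<longleftrightarrow> \<not> r Y" if "\<phi> = [X, Y, X]"
      using adj[OF _ V(2,1), of "s + length (h X)"] s that by (auto simp: occurs_at_append)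
    have neq: "\<not> (X = D \<and> Y = D)" using 1 lrD by auto
    consider "X = D" "Y \<noteq> D" | "X \<noteq> D" "Y = D" | "X \<noteq> D" "Y \<noteq> D" using neq by blast
    then show ?thesis
    proof cases
      case 1
      obtain i where i: "occurs_at (g Y) ruler i" using g by (auto simp: factor_iff)
      have lY: "\<not> l Y" using \<open>l Y \<longleftrightarrow> \<not> r X\<close> lrD 1 by simp
      \<comment> \<open>Fragments \<open>DY\<close> and \<open>DYD\<close> need only that
        \<open>g Y\<close> is a factor: the required zeros adjoin the image of \<open>Y\<close> in
        the ruler word.\<close>
      have "occurs_at (morph G \<phi>) ruler (2 * i)"
        using XY
      proof
        assume "\<phi> = [X, Y]"
        then show ?thesis using GX(1)[OF 1(2) i] lY zero[of i] 1 GD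
          by (simp add: occurs_at_Cons)
      next
        assume e: "\<phi> = [X, Y, X]"
        have "\<not> r Y" using 2[OF e] lrD 1 by simp
        then have "Suc (2 * i) + length (G Y) = 2 * (i + length (g Y))"
          using GX(2)[OF 1(2) i] lY by simp
        then have "occurs_at [0] ruler (Suc (2 * i) + length (G Y))" using zero by metis
        then show ?thesis using GX(1)[OF 1(2) i] lY zero[of i] 1 GD e
          by (simp add: occurs_at_Cons occurs_at_append)
      qed
      then show ?thesis by (auto simp: factor_iff)
    next
      case 2
      obtain i where i: "occurs_at (g X) ruler i" using g by (auto simp: factor_iff)
      have rX: "\<not> r X" using \<open>l Y \<longleftrightarrow> \<not> r X\<close> lrD 2 by simp
      have "2 * i + of_bool (\<not> l X) + length (G X) = 2 * (i + length (g X))"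
        using GX(2)[OF 2(1) i] rX by simp
      then have "occurs_at [0] ruler (2 * i + of_bool (\<not> l X) + length (G X))" using zero by metis
      \<comment> \<open>A fragment \<open>XDX\<close> would call for two adjacent copies of
        \<open>g X\<close>, which nothing guarantees; \<open>mid\<close> excludes it.\<close>
      moreover have "\<phi> = [X, D]" using XY mid \<phi> 2 by auto
      ultimately have "occurs_at (morph G \<phi>) ruler (2 * i + of_bool (\<not> l X))"
        using GX(1)[OF 2(1) i] GD by (simp only: occurs_at_append morph_simps append_Nil2)
      then show ?thesis by (auto simp: factor_iff)
    next
      case 3
      have "D \<notin> set \<phi>" using XY 3 by auto
      then obtain i where i: "occurs_at (morph g \<phi>) ruler i"
        using fg[OF \<phi>] by (auto simp: factor_iff)
      have gX: "occurs_at (g X) ruler i" and gY: "occurs_at (g Y) ruler (i + length (g X))"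
        using i XY by (auto simp: occurs_at_append)
      have XtoY: "2 * i + of_bool (\<not> l X) + length (G X) = 2 * (i + length (g X)) + of_bool (\<not> l Y)"
        using GX(2)[OF 3(1) gX] 1 by simp
      have oY: "occurs_at (G Y) ruler (2 * i + of_bool (\<not> l X) + length (G X))"
        using GX(1)[OF 3(2) gY] unfolding XtoY .
      have "occurs_at (morph G \<phi>) ruler (2 * i + of_bool (\<not> l X))"
        using XY
      proof
        assume "\<phi> = [X, Y]"
        then show ?thesis using GX(1)[OF 3(1) gX] oY by (simp add: occurs_at_append)
      next
        assume e: "\<phi> = [X, Y, X]"
        have gX2: "occurs_at (g X) ruler (i + length (g X) + length (g Y))"
          using i e by (simp add: occurs_at_append)
        have YtoX: "2 * i + of_bool (\<not> l X) + length (G X) + length (G Y)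
            = 2 * (i + length (g X) + length (g Y)) + of_bool (\<not> l X)"
          using GX(2)[OF 3(2) gY] 2[OF e] unfolding XtoY by simp
        have "occurs_at (G X) ruler (2 * i + of_bool (\<not> l X) + length (G X) + length (G Y))"
          using GX(1)[OF 3(1) gX2] unfolding YtoX .
        then show ?thesis using GX(1)[OF 3(1) gX] oY e by (simp add: occurs_at_append)
      qed
      then show ?thesis by (auto simp: factor_iff)
    qed
  qed
  ultimately show ?thesis by blast
qed

text \<open>Induction on the total length of the images: halving changes \<open>h\<close>, while
  removing \<open>D\<close> shrinks \<open>V\<close> and drops the fragments containing
  \<open>D\<close> from \<open>f\<close>. That each \<open>g X\<close> alone is a factor is carried
  along because those fragments are rebuilt from it.\<close>

lemma transfer_to_ruler:
  fixes h :: "'v \<Rightarrow> letter list"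
  assumes "finite V" and "\<And>X. X \<in> V \<Longrightarrow> h X \<noteq> [] \<and> factor (h X) b4"
    and "\<And>\<phi>. \<phi> \<in> f \<Longrightarrow> set \<phi> \<subseteq> V \<and> (\<exists>X Y. \<phi> = [X, Y] \<or> \<phi> = [X, Y, X]) \<and> factor (morph h \<phi>) b4"
  shows "\<exists>g. (\<forall>X. g X \<noteq> [] \<and> factor (g X) ruler) \<and> (\<forall>\<phi>\<in>f. factor (morph g \<phi>) ruler)"
  using assms
proof (induction "\<Sum>X\<in>V. length (h X)" arbitrary: V h f rule: less_induct)
  case less
  note V = less.prems(2) and f = less.prems(3)
  consider "V = {}" | "V \<noteq> {}" "\<forall>X\<in>V. even (length (h X))" | "\<exists>X\<in>V. odd (length (h X))" by blast
  then show ?case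
  proof cases
    case 1
    then have "f = {}" using f by fastforce
    moreover have "factor [0] ruler"
      by (auto simp: factor_iff occurs_at_Cons ruler.simps intro!: exI[of _ 0])
    ultimately show ?thesis by (intro exI[of _ "\<lambda>_. [0]"]) simp
  next
    case 2
    have long: "2 \<le> length (h X)" if "X \<in> V" for X
    proof -
      have "even (length (h X))" "length (h X) \<noteq> 0" using 2 V that by auto
      then show ?thesis by presburger
    qed
    let ?h = "\<lambda>X. halve (h X)"
    have half: "length (?h X) < length (h X) \<and> ?h X \<noteq> [] \<and> factor (?h X) b4" if "X \<in> V" for X
      using V[OF that] length_halve[OF _ long[OF that]] occurs_at_halve[OF _ long[OF that]]
      by (auto simp: factor_iff)
    show ?thesis
    proof (rule less.hyps[of ?h V])
      show "(\<Sum>X\<in>V. length (?h X)) < (\<Sum>X\<in>V. length (h X))"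
        using less.prems(1) 2(1) half by (intro sum_strict_mono) auto
      show "finite V" by fact
      show "?h X \<noteq> [] \<and> factor (?h X) b4" if "X \<in> V" for X using half that by blast
      fix \<phi> assume \<phi>: "\<phi> \<in> f"
      obtain s where "occurs_at (morph h \<phi>) b4 s" using f[OF \<phi>] by (auto simp: factor_iff)
      then have "occurs_at (morph ?h \<phi>) b4 ((s + 1) div 2)"
        using f[OF \<phi>] long by (intro occurs_at_morph_halve) auto
      then show "set \<phi> \<subseteq> V \<and> (\<exists>X Y. \<phi> = [X, Y] \<or> \<phi> = [X, Y, X]) \<and> factor (morph ?h \<phi>) b4"
        using f[OF \<phi>] by (auto simp: factor_iff)
    qed
  next
    case 3
    \<comment> \<open>Restricting to images of odd length loses nothing: in an occurrence of
      \<open>XDX\<close> the lengths for \<open>X\<close> and \<open>D\<close> have an even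
      sum.\<close>
    define S where "S = h ` {X \<in> V. odd (length (h X))}"
    have "\<exists>v\<in>S. \<forall>u\<in>S. \<not> factor (u @ v @ u) b4"
      using less.prems(1) 3 by (intro no_return_in_finite) (auto simp: S_def)
    then obtain D where D: "D \<in> V" "odd (length (h D))"
        "\<And>u. u \<in> S \<Longrightarrow> \<not> factor (u @ h D @ u) b4"
      unfolding S_def by blast
    have mid: "[X, D, X] \<notin> f" for X
    proof
      assume fr: "[X, D, X] \<in> f"
      then have X: "X \<in> V" and fac: "factor (h X @ h D @ h X) b4" using f by fastforce+
      then have "odd (length (h X))"
        using even_return_length[of "h X" "h D"] V[OF X] D(2) by (auto simp: factor_iff)
      then show False using D(3)[of "h X"] X fac by (auto simp: S_def)
    qed
    have "\<exists>g. (\<forall>X. g X \<noteq> [] \<and> factor (g X) ruler)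
      \<and> (\<forall>\<phi>\<in>{\<phi> \<in> f. D \<notin> set \<phi>}. factor (morph g \<phi>) ruler)"
    proof (rule less.hyps[of h "V - {D}"])
      have "(\<Sum>X\<in>V. length (h X)) = length (h D) + (\<Sum>X\<in>V - {D}. length (h X))"
        using less.prems(1) D(1) by (rule sum.remove)
      moreover have "0 < length (h D)" using V[OF D(1)] by simp
      ultimately show "(\<Sum>X\<in>V - {D}. length (h X)) < (\<Sum>X\<in>V. length (h X))" by linarith
      show "finite (V - {D})" using less.prems(1) by simp
      show "h X \<noteq> [] \<and> factor (h X) b4" if "X \<in> V - {D}" for X using that V by blast
      show "set \<phi> \<subseteq> V - {D} \<and> (\<exists>X Y. \<phi> = [X, Y] \<or> \<phi> = [X, Y, X]) \<and> factor (morph h \<phi>) b4"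
        if "\<phi> \<in> {\<phi> \<in> f. D \<notin> set \<phi>}" for \<phi> using that f[of \<phi>] by blast
    qed
    then obtain g where g: "\<And>X. g X \<noteq> [] \<and> factor (g X) ruler"
      "\<And>\<phi>. \<phi> \<in> f \<Longrightarrow> D \<notin> set \<phi> \<Longrightarrow> factor (morph g \<phi>) ruler" by blast
    show ?thesis
      using V D(1) by (intro insert_variable[where V = V and h = h and D = D and g = g] D(2) f mid g) auto
  qed
qed

theorem theorem14:
  fixes f :: "'v list set"
  assumes "hybrid f" and "avoidable f"
  shows "avoids b4 f"
proof (rule ccontr)
  assume "\<not> avoids b4 f"
  then obtain h where h: "occurrence h f b4" by (auto simp: avoids_def)
  have fin: "finite f" using assms(1) by (auto simp: hybrid_def formula_def)
  have form: "\<exists>X Y. \<phi> = [X, Y] \<or> \<phi> = [X, Y, X]" if "\<phi> \<in> f" for \<phi>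
  proof -
    have "length \<phi> = 2 \<or> (\<exists>X Y. \<phi> = [X, Y, X])" using assms(1) that by (auto simp: hybrid_def)
    then show ?thesis by (auto simp: numeral_2_eq_2 length_Suc_conv)
  qed
  let ?V = "\<Union> (set ` f)"
  have "factor (h X) b4" if X: "X \<in> ?V" for X
  proof -
    obtain \<phi> where \<phi>: "\<phi> \<in> f" "X \<in> set \<phi>" using X by blast
    then obtain a b where "\<phi> = a @ X # b" by (meson split_list)
    moreover have "factor (morph h \<phi>) b4" using h \<phi>(1) by (auto simp: occurrence_def)
    ultimately show ?thesis by (auto simp: factor_iff occurs_at_append)
  qed
  moreover have "h X \<noteq> []" for X using h by (auto simp: occurrence_def non_erasing_def)
  ultimately have "\<exists>g. (\<forall>X. g X \<noteq> [] \<and> factor (g X) ruler) \<and> (\<forall>\<phi>\<in>f. factor (morph g \<phi>) ruler)"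
    using fin form h by (intro transfer_to_ruler[of ?V h]) (auto simp: occurrence_def)
  then obtain g where "occurrence g f ruler" by (auto simp: occurrence_def non_erasing_def)
  then show False using not_avoidable_if_occurrence_ruler[OF fin] assms(2) by blast
qed

end
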